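(* Let $u$ and $w$ be two pin words and let $u=u^{(1)}\cdots u^{(j)}$ be the strong numeral-led factor decomposition of $u$. Then $u\preccurlyeq w$ if and only if $w$ can be written as a concatenation $w=v^{(1)}w^{(1)}\cdots v^{(j)}w^{(j)}v^{(j+1)}$ (the $v^{(i)}$ possibly empty) such that for all $i\in\{1,\dots,j\}$, $w^{(i)}\in\mathcal{SP}\cup\mathcal{M}$ and $\phi(w^{(i)})$ has a factor in $\phi(u^{(i)})$.
   Context: Pin words: given a pin sequence representation $(p_1,\dots,p_n)$ of a permutation (a sequence of points, no two on a common horizontal or vertical line, each $p_i$, $i\ge2$, outside the bounding box of the previous ones and either separating $p_{i-1}$ from $\{p_1,\dots,p_{i-2}\}$ by a horizontal or vertical line, or separating no two nonempty subsets of the previous points; order-isomorphic to the diagram of the permutation) and an origin point $p_0$ such that $(p_0,\dots,p_n)$ is still such a sequence, each $p_i$ ($i\ge1$) is encoded by $U$ (resp. $D,L,R$) if $p_i$ separates $p_{i-1}$ from $\{p_0,\dots,p_{i-2}\}$ from the top (resp. bottom, left, right), and by $1$ (resp. $2,3,4$) if $p_i$ separates no two nonempty subsets of $\{p_0,\dots,p_{i-1}\}$ and lies up-right (resp. up-left, bottom-left, bottom-right) of the bounding box of $\{p_0,\dots,p_{i-1}\}$. The resulting word is a pin word. $U,D,L,R$ are directions and $1,2,3,4$ numerals. $\mathcal{SP}$ is the set of strict pin words (a numeral followed only by directions). Every pin word starts with a numeral; cutting it before each numeral gives its strong numeral-led factor decomposition, whose factors are strict pin words. The order $\preccurlyeq$: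 for pin words $u=u^{(1)}\cdots u^{(j)}$ (strong numeral-led decomposition) and $w$, $u\preccurlyeq w$ iff $w=v^{(1)}w^{(1)}\cdots v^{(j)}w^{(j)}v^{(j+1)}$ with, for all $i$: if $w^{(i)}$ begins with a numeral then $w^{(i)}=u^{(i)}$; if $w^{(i)}$ begins with a direction then $v^{(i)}$ is nonempty, the point encoded by the first letter of $w^{(i)}$ lies in the quadrant with respect to the origin $p_0$ of the encoding $w$ given by the first letter of $u^{(i)}$ (quadrant $1,2,3,4$ = up-right, up-left, bottom-left, bottom-right of $p_0$), and all other letters of $u^{(i)}$ and $w^{(i)}$ agree. $\mathcal{M}$: words of length at least $2$ over $\{U,D,L,R\}$ in which letters of $\{L,R\}$ and of $\{U,D\}$ alternate. The map $\phi$ is the identity on $\mathcal{M}$; on a strict pin word $u=u'u''$ with $|u'|=2$, $\phi(u)=\varphi(u')u''$ where $\varphi$: $1R\mapsto RUR$, $1L\mapsto RUL$, $1U\mapsto URU$, $1D\mapsto URD$, $2R\mapsto LUR$, $2L\mapsto LUL$, $2U\mapsto ULU$, $2D\mapsto ULD$, $3R\mapsto LDR$, $3L\mapsto LDL$, $3U\mapsto DLU$, $3D\mapsto DLD$, $4R\mapsto RDR$, $4L\mapsto RDL$, $4U\mapsto DRU$, $4D\mapsto DRD$; on single numerals $\phi(1)=\{UR,RU\}$, $\phi(2)=\{UL,LU\}$, $\phi(3)=\{DL,LD\}$, $\phi(4)=\{RD,DR\}$. "$\phi(x)$ has a factor in $\phi(u)$" means: if $|u|=1$, $\phi(x)$ has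 a factor in the two-element set $\phi(u)$; if $|u|\ge2$, the word $\phi(u)$ is a factor of $\phi(x)$. *)

theory Defs
  imports Complex_Main "HOL-Combinatorics.Permutations" "HOL-Library.Sublist"
begin

section \<open>Pin sequences and pin representations\<close>

type_synonym point = "real \<times> real"

definition bounding_box :: "point set \<Rightarrow> point set" where
  "bounding_box S = {Min (fst ` S)..Max (fst ` S)} \<times> {Min (snd ` S)..Max (snd ` S)}"

text \<open>Separation of \<open>A\<close> from \<open>B\<close> by the vertical (resp. horizontal) line through \<open>p\<close>.
  Both sets have to be nonempty; in particular, a point never separates a point from the empty set.\<close>

definition separates_vert :: "point \<Rightarrow> point set \<Rightarrow> point set \<Rightarrow> bool" where
  "separates_vert p A B \<longleftrightarrow> A \<noteq> {} \<and> B \<noteq> {} \<and>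
     ((\<forall>a\<in>A. fst a < fst p) \<and> (\<forall>b\<in>B. fst p < fst b) \<or>
      (\<forall>a\<in>A. fst p < fst a) \<and> (\<forall>b\<in>B. fst b < fst p))"

definition separates_horiz :: "point \<Rightarrow> point set \<Rightarrow> point set \<Rightarrow> bool" where
  "separates_horiz p A B \<longleftrightarrow> A \<noteq> {} \<and> B \<noteq> {} \<and>
     ((\<forall>a\<in>A. snd a < snd p) \<and> (\<forall>b\<in>B. snd p < snd b) \<or>
      (\<forall>a\<in>A. snd p < snd a) \<and> (\<forall>b\<in>B. snd b < snd p))"

definition separates :: "point \<Rightarrow> point set \<Rightarrow> point set \<Rightarrow> bool" where
  "separates p A B \<longleftrightarrow> separates_vert p A B \<or> separates_horiz p A B"

definition independent_of :: "point \<Rightarrow> point set \<Rightarrow> bool" where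
  "independent_of p S \<longleftrightarrow> \<not> (\<exists>A B. A \<subseteq> S \<and> B \<subseteq> S \<and> separates p A B)"

definition pin_sequence :: "point list \<Rightarrow> bool" where
  "pin_sequence ps \<longleftrightarrow> distinct (map fst ps) \<and> distinct (map snd ps) \<and>
     (\<forall>i. 1 \<le> i \<and> i < length ps \<longrightarrow>
        ps ! i \<notin> bounding_box (set (take i ps)) \<and>
        (separates (ps ! i) {ps ! (i - 1)} (set (take (i - 1) ps)) \<or>
         independent_of (ps ! i) (set (take i ps))))"

definition diagram :: "nat \<Rightarrow> (nat \<Rightarrow> nat) \<Rightarrow> point set" where
  "diagram n \<sigma> = {(real i, real (\<sigma> i)) | i. i \<in> {1..n}}"

definition order_isomorphic :: "point set \<Rightarrow> point set \<Rightarrow> bool" where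
  "order_isomorphic S T \<longleftrightarrow> (\<exists>f. bij_betw f S T \<and>
     (\<forall>p\<in>S. \<forall>q\<in>S. (fst p < fst q \<longleftrightarrow> fst (f p) < fst (f q)) \<and>
                   (snd p < snd q \<longleftrightarrow> snd (f p) < snd (f q))))"

definition pin_representation :: "nat \<Rightarrow> (nat \<Rightarrow> nat) \<Rightarrow> point list \<Rightarrow> bool" where
  "pin_representation n \<sigma> ps \<longleftrightarrow>
     \<sigma> permutes {1..n} \<and> pin_sequence ps \<and> order_isomorphic (set ps) (diagram n \<sigma>)"


section \<open>Pin words\<close>

text \<open>The constructors \<open>N1\<close>, \<dots>, \<open>N4\<close> stand for the numerals 1, 2, 3, 4.\<close>

datatype letter = N1 | N2 | N3 | N4 | U | D | L | R

definition numerals :: "letter set" where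
  "numerals = {N1, N2, N3, N4}"

definition directions :: "letter set" where
  "directions = {U, D, L, R}"

text \<open>\<open>in_quadrant a p B\<close>: \<open>p\<close> lies in the quadrant numbered \<open>a\<close> with respect to
  (every point of) \<open>B\<close>.\<close>

fun in_quadrant :: "letter \<Rightarrow> point \<Rightarrow> point set \<Rightarrow> bool" where
  "in_quadrant N1 p B \<longleftrightarrow> (\<forall>b\<in>B. fst b < fst p \<and> snd b < snd p)"
| "in_quadrant N2 p B \<longleftrightarrow> (\<forall>b\<in>B. fst p < fst b \<and> snd b < snd p)"
| "in_quadrant N3 p B \<longleftrightarrow> (\<forall>b\<in>B. fst p < fst b \<and> snd p < snd b)"
| "in_quadrant N4 p B \<longleftrightarrow> (\<forall>b\<in>B. fst b < fst p \<and> snd p < snd b)"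
| "in_quadrant _ p B \<longleftrightarrow> False"

text \<open>\<open>encodes_pin a ps i\<close>: in the sequence \<open>ps\<close>, whose first element is the origin \<open>p\<^sub>0\<close>,
  the letter \<open>a\<close> encodes the point \<open>p\<^sub>i\<close> (for \<open>i \<ge> 1\<close>).\<close>

fun encodes_pin :: "letter \<Rightarrow> point list \<Rightarrow> nat \<Rightarrow> bool" where
  "encodes_pin U ps i \<longleftrightarrow> (\<forall>q \<in> bounding_box (set (take i ps)). snd q < snd (ps ! i)) \<and>
     separates_vert (ps ! i) {ps ! (i - 1)} (set (take (i - 1) ps))"
| "encodes_pin D ps i \<longleftrightarrow> (\<forall>q \<in> bounding_box (set (take i ps)). snd (ps ! i) < snd q) \<and>
     separates_vert (ps ! i) {ps ! (i - 1)} (set (take (i - 1) ps))"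
| "encodes_pin L ps i \<longleftrightarrow> (\<forall>q \<in> bounding_box (set (take i ps)). fst (ps ! i) < fst q) \<and>
     separates_horiz (ps ! i) {ps ! (i - 1)} (set (take (i - 1) ps))"
| "encodes_pin R ps i \<longleftrightarrow> (\<forall>q \<in> bounding_box (set (take i ps)). fst q < fst (ps ! i)) \<and>
     separates_horiz (ps ! i) {ps ! (i - 1)} (set (take (i - 1) ps))"
| "encodes_pin a ps i \<longleftrightarrow> independent_of (ps ! i) (set (take i ps)) \<and>
     in_quadrant a (ps ! i) (bounding_box (set (take i ps)))"

text \<open>\<open>pin_encoding p\<^sub>0 ps w\<close>: \<open>w\<close> encodes the pin representation \<open>ps = (p\<^sub>1, \<dots>, p\<^sub>n)\<close> of some
  permutation of size \<open>n \<ge> 1\<close> with respect to the origin \<open>p\<^sub>0\<close>.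
  Thus \<open>w ! i\<close> is the letter of \<open>p\<^sub>i\<^sub>+\<^sub>1 = ps ! i\<close>.\<close>

definition pin_encoding :: "point \<Rightarrow> point list \<Rightarrow> letter list \<Rightarrow> bool" where
  "pin_encoding p0 ps w \<longleftrightarrow>
     (\<exists>n \<sigma>. n \<ge> 1 \<and> pin_representation n \<sigma> ps) \<and> pin_sequence (p0 # ps) \<and>
     length w = length ps \<and>
     (\<forall>i < length w. encodes_pin (w ! i) (p0 # ps) (Suc i))"

definition pin_word :: "letter list \<Rightarrow> bool" where
  "pin_word w \<longleftrightarrow> (\<exists>p0 ps. pin_encoding p0 ps w)"

definition SP :: "letter list set" where
  "SP = {w. pin_word w \<and> w \<noteq> [] \<and> hd w \<in> numerals \<and> set (tl w) \<subseteq> directions}"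

text \<open>The strong numeral-led factor decomposition: a pin word, which starts with a numeral, is cut
  before each of its numerals.\<close>

function strong_decomp :: "letter list \<Rightarrow> letter list list" where
  "strong_decomp [] = []"
| "strong_decomp (a # u) =
     (a # takeWhile (\<lambda>x. x \<in> directions) u) # strong_decomp (dropWhile (\<lambda>x. x \<in> directions) u)"
  by pat_completeness auto
termination
  by (relation "measure length") (auto simp: le_imp_less_Suc length_dropWhile_le)


section \<open>The order on pin words\<close>

text \<open>With indices shifted to start from 0, \<open>interleave v x i\<close> is
  \<open>v 0 @ x 0 @ \<dots> @ v (i - 1) @ x (i - 1) @ v i\<close>. It serves as the full concatenation (for \<open>i = j\<close>)
  and as the prefix preceding the factor \<open>x i\<close> (for \<open>i < j\<close>), so that the first letter of \<open>x i\<close>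
  is the letter of index \<open>length (interleave v x i)\<close> in the full word.\<close>

definition interleave :: "(nat \<Rightarrow> 'a list) \<Rightarrow> (nat \<Rightarrow> 'a list) \<Rightarrow> nat \<Rightarrow> 'a list" where
  "interleave v x i = concat (map (\<lambda>l. v l @ x l) [0..<i]) @ v i"

text \<open>The quadrant of a point encoded by a letter of \<open>w\<close> depends only on \<open>w\<close>, not on the pin
  representation and origin \<open>(p0, ps)\<close> it encodes; hence quantifying these existentially is harmless.\<close>

definition pin_le :: "letter list \<Rightarrow> letter list \<Rightarrow> bool"  (infix "\<preceq>" 50) where
  "u \<preceq> w \<longleftrightarrow> (\<exists>p0 ps v x. pin_encoding p0 ps w \<and>
     w = interleave v x (length (strong_decomp u)) \<and>
     (\<forall>i < length (strong_decomp u). x i \<noteq> [] \<and>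
        (hd (x i) \<in> numerals \<longrightarrow> x i = strong_decomp u ! i) \<and>
        (hd (x i) \<in> directions \<longrightarrow>
           v i \<noteq> [] \<and>
           in_quadrant (hd (strong_decomp u ! i)) (ps ! length (interleave v x i)) {p0} \<and>
           tl (x i) = tl (strong_decomp u ! i))))"


section \<open>The map \<open>\<phi>\<close>\<close>

definition \<M> :: "letter list set" where
  "\<M> = {u. length u \<ge> 2 \<and> set u \<subseteq> directions \<and>
     (\<forall>i. Suc i < length u \<longrightarrow> (u ! i \<in> {L, R} \<longleftrightarrow> u ! Suc i \<in> {U, D}))}"

fun varphi :: "letter \<Rightarrow> letter \<Rightarrow> letter list" where
  "varphi N1 R = [R, U, R]" | "varphi N1 L = [R, U, L]"
| "varphi N1 U = [U, R, U]" | "varphi N1 D = [U, R, D]"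
| "varphi N2 R = [L, U, R]" | "varphi N2 L = [L, U, L]"
| "varphi N2 U = [U, L, U]" | "varphi N2 D = [U, L, D]"
| "varphi N3 R = [L, D, R]" | "varphi N3 L = [L, D, L]"
| "varphi N3 U = [D, L, U]" | "varphi N3 D = [D, L, D]"
| "varphi N4 R = [R, D, R]" | "varphi N4 L = [R, D, L]"
| "varphi N4 U = [D, R, U]" | "varphi N4 D = [D, R, D]"
| "varphi _ _ = undefined"

fun phi_numeral :: "letter \<Rightarrow> letter list set" where
  "phi_numeral N1 = {[U, R], [R, U]}"
| "phi_numeral N2 = {[U, L], [L, U]}"
| "phi_numeral N3 = {[D, L], [L, D]}"
| "phi_numeral N4 = {[R, D], [D, R]}"
| "phi_numeral _ = undefined"

text \<open>As \<open>\<phi>\<close> takes two-element sets as values on single numerals, it is made set-valued throughout: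
  a word value is represented by the corresponding singleton. Outside of \<open>SP \<union> \<M>\<close> the value of
  \<open>phi\<close> is irrelevant.\<close>

definition phi :: "letter list \<Rightarrow> letter list set" where
  "phi u = (if u \<in> \<M> then {u}
            else if length u = 1 then phi_numeral (hd u)
            else {varphi (u ! 0) (u ! 1) @ drop 2 u})"

text \<open>\<open>\<phi>(x)\<close> has a factor in \<open>\<phi>(u)\<close>. When \<open>x\<close> is a single numeral, this means that one of the two
  words in \<open>\<phi>(x)\<close> has such a factor.\<close>

definition phi_has_factor_in :: "letter list \<Rightarrow> letter list \<Rightarrow> bool" where
  "phi_has_factor_in x u \<longleftrightarrow> (\<exists>y \<in> phi x. \<exists>z \<in> phi u. sublist z y)"

end

theory Submission imports Defs begin

text \<open>Let \<open>c\<close> be a direction of a pin word and \<open>b\<close> the letter before it. The quadrant (with respect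
  to the origin) of the point encoded by \<open>c\<close> is the corner between \<open>c\<close> and \<open>side b c\<close>, where
  \<open>side b c\<close> is \<open>b\<close> itself if \<open>b\<close> is a direction, and otherwise the side of the quadrant \<open>b\<close> that is
  perpendicular to \<open>c\<close>; and \<open>varphi b c\<close> ends with \<open>side b c\<close> and \<open>c\<close>. As \<open>\<phi>\<close> replaces the leading
  numeral of a strict pin word by the two sides of its quadrant, occurrences of \<open>\<phi>(a t)\<close> in \<open>\<phi>(x)\<close>
  that are not prefixes correspond to occurrences in \<open>x\<close> of a word \<open>c t\<close> whose first point lies in
  the quadrant \<open>a\<close>, preceded by at least one letter.\<close>

section \<open>Geometry of pin sequences\<close>

lemma subset_bounding_box:
  assumes "finite S"
  shows "S \<subseteq> bounding_box S"
proof
  fix p assume "p \<in> S"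
  then show "p \<in> bounding_box S"
    using assms by (cases p) (force simp: bounding_box_def intro: Min_le Max_ge)
qed

lemma bounding_box_mono:
  assumes "finite T" "S \<subseteq> T" "S \<noteq> {}"
  shows "bounding_box S \<subseteq> bounding_box T"
proof -
  have "Min (f ` T) \<le> Min (f ` S)" "Max (f ` S) \<le> Max (f ` T)" for f :: "point \<Rightarrow> real"
    using assms by (auto intro!: Min_antimono Max_mono)
  then show ?thesis
    by (fastforce simp: bounding_box_def intro: order_trans)
qed

lemma separates_vert_mono:
  "separates_vert p A B \<Longrightarrow> C \<subseteq> B \<Longrightarrow> C \<noteq> {} \<Longrightarrow> separates_vert p A C"
  by (auto simp: separates_vert_def)

lemma separates_horiz_mono:
  "separates_horiz p A B \<Longrightarrow> C \<subseteq> B \<Longrightarrow> C \<noteq> {} \<Longrightarrow> separates_horiz p A C"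
  by (auto simp: separates_horiz_def)

lemma separates_mono:
  "separates p A B \<Longrightarrow> C \<subseteq> B \<Longrightarrow> C \<noteq> {} \<Longrightarrow> separates p A C"
  by (auto simp: separates_def intro: separates_vert_mono separates_horiz_mono)

lemma independent_of_mono: "independent_of p T \<Longrightarrow> S \<subseteq> T \<Longrightarrow> independent_of p S"
  unfolding independent_of_def by blast

lemma independent_of_singleton: "independent_of p {q}"
  by (auto simp: independent_of_def separates_def separates_vert_def separates_horiz_def
      subset_singleton_iff)

lemma in_quadrant_mono: "in_quadrant a p T \<Longrightarrow> S \<subseteq> T \<Longrightarrow> in_quadrant a p S"
  by (cases a) auto

text \<open>All of \<open>B\<close> lies on one side of \<open>p\<close> and \<open>q\<close> on the
  other, so \<open>q\<close> cannot lie strictly between \<open>b\<close> and the points of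
  \<open>C\<close>, which all belong to \<open>B\<close>. This is why two consecutive directions
  cannot share an axis.\<close>

lemma not_separates_vert_twice:
  assumes "separates_vert p {q} B" "separates_vert q {b} C" "b \<in> B" "C \<subseteq> B"
  shows False
  using assms by (fastforce simp: separates_vert_def)

lemma not_separates_horiz_twice:
  assumes "separates_horiz p {q} B" "separates_horiz q {b} C" "b \<in> B" "C \<subseteq> B"
  shows False
  using assms by (fastforce simp: separates_horiz_def)

section \<open>Ranks and permutation diagrams\<close>

text \<open>If \<open>f p < f q\<close>, the lower set of \<open>p\<close> is properly contained in
  that of \<open>q\<close>, as \<open>q\<close> belongs only to the latter. Applied to both
  coordinates, this replaces a point by a pair of ranks.\<close>

lemma bij_betw_rank:
  fixes f :: "'a \<Rightarrow> 'b::linorder"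
  assumes "finite S" "inj_on f S"
  shows "bij_betw (\<lambda>p. card {q \<in> S. f q \<le> f p}) S {1..card S}"
    and "\<And>p q. p \<in> S \<Longrightarrow> q \<in> S \<Longrightarrow>
      card {r \<in> S. f r \<le> f p} < card {r \<in> S. f r \<le> f q} \<longleftrightarrow> f p < f q"
proof -
  let ?r = "\<lambda>p. card {q \<in> S. f q \<le> f p}"
  have less: "?r p < ?r q" if "q \<in> S" "f p < f q" for p q
  proof (rule psubset_card_mono)
    have "q \<in> {r \<in> S. f r \<le> f q} - {r \<in> S. f r \<le> f p}"
      using that by auto
    then show "{r \<in> S. f r \<le> f p} \<subset> {r \<in> S. f r \<le> f q}"
      using that(2) by fastforce
  qed (use assms(1) in simp)
  have le: "?r p \<le> ?r q" if "f p \<le> f q" for p q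
    using that assms(1) by (intro card_mono) auto
  show less_iff: "?r p < ?r q \<longleftrightarrow> f p < f q" if "p \<in> S" "q \<in> S" for p q
    using less[OF that(2)] le[of q p] by (meson linorder_not_less)
  have inj: "inj_on ?r S"
  proof (rule inj_onI)
    fix p q assume pq: "p \<in> S" "q \<in> S" and "?r p = ?r q"
    then have "\<not> f p < f q" "\<not> f q < f p"
      using less_iff[OF pq] less_iff[OF pq(2,1)] by simp_all
    then show "p = q"
      using inj_onD[OF assms(2) _ pq] by simp
  qed
  have "?r p \<in> {1..card S}" if "p \<in> S" for p
  proof -
    have "0 < ?r p"
      using that assms(1) by (subst card_gt_0_iff) auto
    then show ?thesis
      using assms(1) by (auto intro: card_mono)
  qed
  then have "?r ` S \<subseteq> {1..card S}"
    by blast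
  then have "?r ` S = {1..card S}"
    by (intro card_subset_eq) (auto simp: card_image[OF inj])
  then show "bij_betw ?r S {1..card S}"
    using inj by (simp add: bij_betw_def)
qed

lemma ex_order_isomorphic_diagram:
  fixes S :: "point set"
  assumes "finite S" "inj_on fst S" "inj_on snd S"
  shows "\<exists>\<sigma>. \<sigma> permutes {1..card S} \<and> order_isomorphic S (diagram (card S) \<sigma>)"
proof -
  define r where "r = (\<lambda>p::point. card {q \<in> S. fst q \<le> fst p})"
  define c where "c = (\<lambda>p::point. card {q \<in> S. snd q \<le> snd p})"
  note r = bij_betw_rank[OF assms(1,2), folded r_def]
  note c = bij_betw_rank[OF assms(1,3), folded c_def]
  \<comment> \<open>The horizontal rank of a point is sent to its vertical rank; fixing everything
    outside \<open>{1..card S}\<close> is what \<open>permutes\<close> demands.\<close>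
  define \<sigma> where "\<sigma> = (\<lambda>i. if i \<in> {1..card S} then c (inv_into S r i) else i)"
  have "bij_betw (c \<circ> inv_into S r) {1..card S} {1..card S}"
    using bij_betw_trans[OF bij_betw_inv_into[OF r(1)] c(1)] .
  then have "bij_betw \<sigma> {1..card S} {1..card S}"
    by (rule bij_betw_cong[THEN iffD1, rotated]) (simp add: \<sigma>_def)
  then have "\<sigma> permutes {1..card S}"
    by (rule bij_imp_permutes) (simp only: \<sigma>_def if_False)
  moreover have \<sigma>_r: "\<sigma> (r p) = c p" if "p \<in> S" for p
    using that r(1) bij_betwE[OF r(1)] by (auto simp: \<sigma>_def bij_betw_inv_into_left)
  have "order_isomorphic S (diagram (card S) \<sigma>)"
    unfolding order_isomorphic_def
  proof (intro exI conjI)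
    let ?f = "\<lambda>p. (real (r p), real (c p))"
    have "inj_on ?f S"
      using r(1) by (auto simp: bij_betw_def inj_on_def)
    moreover have "?f ` S = (\<lambda>i. (real i, real (\<sigma> i))) ` r ` S"
      by (auto simp: image_image \<sigma>_r)
    then have "?f ` S = diagram (card S) \<sigma>"
      using r(1) by (auto simp: bij_betw_def diagram_def)
    ultimately show "bij_betw ?f S (diagram (card S) \<sigma>)"
      by (simp add: bij_betw_def)
    show "\<forall>p\<in>S. \<forall>q\<in>S. (fst p < fst q \<longleftrightarrow> fst (?f p) < fst (?f q)) \<and>
        (snd p < snd q \<longleftrightarrow> snd (?f p) < snd (?f q))"
      using r(2) c(2) by (simp add: r_def c_def)
  qed
  ultimately show ?thesis
    by blast
qed

text \<open>Distinct coordinates already determine a permutation, so the clause of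
  \<open>pin_encoding\<close> about representations follows from
  \<open>pin_sequence\<close>.\<close>

lemma pin_sequence_imp_representation:
  assumes "pin_sequence ps"
  shows "\<exists>\<sigma>. pin_representation (length ps) \<sigma> ps"
proof -
  have "distinct (map fst ps)" "distinct (map snd ps)"
    using assms by (auto simp: pin_sequence_def)
  then have "inj_on fst (set ps)" "inj_on snd (set ps)" "card (set ps) = length ps"
    by (auto simp: distinct_map distinct_card)
  then show ?thesis
    using ex_order_isomorphic_diagram[of "set ps"] assms by (auto simp: pin_representation_def)
qed

text \<open>The first point of \<open>qs\<close> is exempt from the shift, so that it may be the origin.\<close>

lemma pin_sequence_shift:
  assumes "pin_sequence ps" "distinct (map fst qs)" "distinct (map snd qs)"
    and shift: "\<And>i. 1 \<le> i \<Longrightarrow> i < length qs \<Longrightarrow> e + i < length ps \<and> qs ! i = ps ! (e + i)"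
    and sub: "\<And>i. 1 \<le> i \<Longrightarrow> set (take i qs) \<subseteq> set (take (e + i) ps)"
  shows "pin_sequence qs"
  unfolding pin_sequence_def
proof (intro conjI assms(2,3) allI impI)
  fix i assume i: "1 \<le> i \<and> i < length qs"
  have nth: "e + i < length ps" "qs ! i = ps ! (e + i)" and ne: "set (take i qs) \<noteq> {}"
    using i shift[of i] by auto
  have old: "ps ! (e + i) \<notin> bounding_box (set (take (e + i) ps))"
    "separates (ps ! (e + i)) {ps ! (e + i - 1)} (set (take (e + i - 1) ps)) \<or>
      independent_of (ps ! (e + i)) (set (take (e + i) ps))"
    using assms(1) nth(1) i by (auto simp: pin_sequence_def)
  show "qs ! i \<notin> bounding_box (set (take i qs))"
    using old(1) bounding_box_mono[OF _ sub ne] i nth(2) by auto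
  show "separates (qs ! i) {qs ! (i - 1)} (set (take (i - 1) qs)) \<or>
      independent_of (qs ! i) (set (take i qs))"
  proof (cases "i = 1")
    \<comment> \<open>A single earlier point cannot be split into two separated sets, so this pin is
      independent even if its original was separating.\<close>
    case True
    then have "set (take i qs) = {qs ! 0}"
      using i by (cases qs) auto
    then show ?thesis
      by (simp add: independent_of_singleton)
  next
    case False
    then obtain k where k: "i = Suc k" "1 \<le> k" "k < length qs"
      using i by (cases i) auto
    then have "set (take (i - 1) qs) \<noteq> {}" "qs ! (i - 1) = ps ! (e + i - 1)"
      "set (take (i - 1) qs) \<subseteq> set (take (e + i - 1) ps)"
      using shift[of k] sub[of k] by auto
    then show ?thesis
      using old(2) sub[of i] i nth(2) by (auto intro: separates_mono independent_of_mono)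
  qed
qed

section \<open>Pin words\<close>

lemma not_in_directions_iff: "a \<notin> directions \<longleftrightarrow> a \<in> numerals"
  by (cases a) (auto simp: numerals_def directions_def)

lemma encodes_pin_extremal:
  assumes "encodes_pin a ps i" "q \<in> set (take i ps)"
  shows "a \<in> {R, N1, N4} \<Longrightarrow> fst q < fst (ps ! i)"
    and "a \<in> {L, N2, N3} \<Longrightarrow> fst (ps ! i) < fst q"
    and "a \<in> {U, N1, N2} \<Longrightarrow> snd q < snd (ps ! i)"
    and "a \<in> {D, N3, N4} \<Longrightarrow> snd (ps ! i) < snd q"
proof -
  have q: "q \<in> bounding_box (set (take i ps))"
    using assms(2) subset_bounding_box[of "set (take i ps)"] by auto
  show "a \<in> {R, N1, N4} \<Longrightarrow> fst q < fst (ps ! i)"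
    "a \<in> {L, N2, N3} \<Longrightarrow> fst (ps ! i) < fst q"
    "a \<in> {U, N1, N2} \<Longrightarrow> snd q < snd (ps ! i)"
    "a \<in> {D, N3, N4} \<Longrightarrow> snd (ps ! i) < snd q"
    using assms(1) q by auto
qed

lemma encodes_pin_separates:
  assumes "encodes_pin a ps i"
  shows "a \<in> {U, D} \<Longrightarrow> separates_vert (ps ! i) {ps ! (i - 1)} (set (take (i - 1) ps))"
    and "a \<in> {L, R} \<Longrightarrow> separates_horiz (ps ! i) {ps ! (i - 1)} (set (take (i - 1) ps))"
  using assms by auto

text \<open>Lying beyond a box and separating a point from a set both survive when the box and the
  set shrink. Separation needs a nonempty set, which \<open>1 < j\<close> guarantees.\<close>

lemma encodes_pin_direction_shift:
  assumes "encodes_pin a ps i" "a \<in> directions" "qs ! j = ps ! i" "qs ! (j - 1) = ps ! (i - 1)"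
    and "set (take (j - 1) qs) \<subseteq> set (take (i - 1) ps)" "set (take j qs) \<subseteq> set (take i ps)"
    and "1 < j" "qs \<noteq> []"
  shows "encodes_pin a qs j"
proof -
  have ne: "set (take (j - 1) qs) \<noteq> {}" "set (take j qs) \<noteq> {}"
    using assms(7,8) by auto
  note bb = bounding_box_mono[OF _ assms(6) ne(2)]
  show ?thesis
    using assms(1,2) subsetD[OF bb] separates_vert_mono[OF _ assms(5) ne(1)]
      separates_horiz_mono[OF _ assms(5) ne(1)]
    by (cases a) (simp_all add: directions_def assms(3) assms(4)[simplified] del: split_paired_All)
qed

section \<open>Consecutive letters and the quadrants of points\<close>

text \<open>Only two directions along one axis are excluded; a numeral is compatible with every
  letter.\<close>

definition alternate :: "letter \<Rightarrow> letter \<Rightarrow> bool" where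
  "alternate b c \<longleftrightarrow> \<not> (b \<in> {L, R} \<and> c \<in> {L, R}) \<and> \<not> (b \<in> {U, D} \<and> c \<in> {U, D})"

definition side :: "letter \<Rightarrow> letter \<Rightarrow> letter" where
  "side b c = (if b \<in> directions then b else varphi b c ! 1)"

lemma pin_encoding_alternate:
  assumes "pin_encoding p0 ps w" "Suc k < length w"
  shows "alternate (w ! k) (w ! Suc k)"
proof -
  define P where "P = p0 # ps"
  have len: "length w = length ps"
    and enc: "\<And>i. i < length w \<Longrightarrow> encodes_pin (w ! i) P (Suc i)"
    using assms(1) by (auto simp: pin_encoding_def P_def)
  have b: "encodes_pin (w ! k) P (Suc k)" and c: "encodes_pin (w ! Suc k) P (Suc (Suc k))"
    using enc assms(2) by auto
  have "k < length P"
    using assms(2) len by (simp add: P_def)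
  then have mem: "P ! k \<in> set (take (Suc k) P)" "set (take k P) \<subseteq> set (take (Suc k) P)"
    by (auto simp: take_Suc_conv_app_nth)
  show ?thesis
    using encodes_pin_separates[OF b] encodes_pin_separates[OF c]
      not_separates_vert_twice[OF _ _ mem] not_separates_horiz_twice[OF _ _ mem]
    unfolding alternate_def by (metis diff_Suc_1)
qed

text \<open>The letter \<open>c\<close> fixes the side of \<open>p0\<close> along its own axis. In
  the other coordinate, \<open>q\<close> lies strictly between \<open>p\<close> and
  \<open>p0\<close>, because it separates \<open>p\<close> from a set containing the origin. Hence
  \<open>q\<close> is there on the same side of \<open>p0\<close> as \<open>p\<close>, and this side
  is read off \<open>b\<close>.\<close>

lemma pin_encoding_quadrant:
  assumes "pin_encoding p0 ps w" "Suc k < length w" "w ! Suc k \<in> directions" "a \<in> numerals"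
  shows "in_quadrant a (ps ! Suc k) {p0} \<longleftrightarrow> [side (w ! k) (w ! Suc k), w ! Suc k] \<in> phi_numeral a"
proof -
  define b c p q where bcpq: "b = w ! k" "c = w ! Suc k" "p = ps ! k" "q = ps ! Suc k"
  have b: "encodes_pin b (p0 # ps) (Suc k)" and c: "encodes_pin c (p0 # ps) (Suc (Suc k))"
    using assms(1,2) by (auto simp: pin_encoding_def bcpq)
  have mem: "p0 \<in> set (take (Suc k) (p0 # ps))" "p0 \<in> set (take (Suc (Suc k)) (p0 # ps))"
    by auto
  have alt: "alternate b c"
    unfolding bcpq by (rule pin_encoding_alternate[OF assms(1,2)])
  have between: "c \<in> {U, D} \<Longrightarrow> fst p < fst q \<and> fst q < fst p0 \<or> fst p0 < fst q \<and> fst q < fst p"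
    "c \<in> {L, R} \<Longrightarrow> snd p < snd q \<and> snd q < snd p0 \<or> snd p0 < snd q \<and> snd q < snd p"
    using encodes_pin_separates[OF c] by (auto simp: separates_vert_def separates_horiz_def bcpq)
  note b_ext = encodes_pin_extremal[OF b mem(1), unfolded nth_Cons_Suc, folded bcpq]
  note c_ext = encodes_pin_extremal[OF c mem(2), unfolded nth_Cons_Suc, folded bcpq]
  define s where "s = side b c"
  \<comment> \<open>Alternation leaves for \<open>b\<close> only a direction perpendicular to
    \<open>c\<close> or a numeral.\<close>
  have side_b: "c \<in> {U, D} \<Longrightarrow> s = R \<and> b \<in> {R, N1, N4} \<or> s = L \<and> b \<in> {L, N2, N3}"
    "c \<in> {L, R} \<Longrightarrow> s = U \<and> b \<in> {U, N1, N2} \<or> s = D \<and> b \<in> {D, N3, N4}"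
    using alt by (cases b; auto simp: s_def side_def alternate_def directions_def)+
  have s: "c \<in> {U, D} \<Longrightarrow> s = R \<and> fst p0 < fst q \<or> s = L \<and> fst q < fst p0"
    "c \<in> {L, R} \<Longrightarrow> s = U \<and> snd p0 < snd q \<or> s = D \<and> snd q < snd p0"
    using side_b b_ext between by (meson less_asym less_trans)+
  have "c = U \<or> c = D \<or> c = L \<or> c = R"
    using assms(3) by (auto simp: directions_def bcpq)
  then have "in_quadrant a q {p0} \<longleftrightarrow> [s, c] \<in> phi_numeral a"
    using s c_ext assms(4) by (cases a) (auto simp: numerals_def)
  then show ?thesis
    by (simp add: bcpq s_def)
qed

text \<open>No point precedes the origin, so the first pin has nothing from which to separate it and
  cannot be encoded by a direction.\<close>

lemma hd_pin_word:
  assumes "pin_word w"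
  shows "w \<noteq> []" "hd w \<in> numerals"
proof -
  obtain p0 ps where enc: "pin_encoding p0 ps w"
    using assms by (auto simp: pin_word_def)
  then obtain n \<sigma> where "n \<ge> 1" "pin_representation n \<sigma> ps" and len: "length w = length ps"
    by (auto simp: pin_encoding_def)
  then have "diagram n \<sigma> \<noteq> {}" "order_isomorphic (set ps) (diagram n \<sigma>)"
    by (auto simp: diagram_def pin_representation_def)
  then have "ps \<noteq> []"
    by (auto simp: order_isomorphic_def bij_betw_def)
  then show ne: "w \<noteq> []"
    using len by auto
  then have "encodes_pin (w ! 0) (p0 # ps) (Suc 0)"
    using enc by (auto simp: pin_encoding_def)
  then have "w ! 0 \<notin> directions"
    using encodes_pin_separates[of "w ! 0" "p0 # ps" "Suc 0"]
    by (auto simp: directions_def separates_vert_def separates_horiz_def)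
  then show "hd w \<in> numerals"
    using ne by (simp add: not_in_directions_iff hd_conv_nth)
qed

text \<open>The points of the factor together with the origin of the whole word form a pin sequence.\<close>

lemma strict_factor_in_SP:
  assumes "pin_word (\<alpha> @ (a # t) @ \<beta>)" "a \<in> numerals" "set t \<subseteq> directions"
  shows "a # t \<in> SP"
proof -
  let ?w = "\<alpha> @ (a # t) @ \<beta>" and ?n = "length (a # t)" and ?e = "length \<alpha>"
  obtain p0 ps where enc: "pin_encoding p0 ps ?w"
    using assms(1) by (auto simp: pin_word_def)
  then have len: "length ps = ?e + ?n + length \<beta>"
    and letters: "\<And>i. i < length ?w \<Longrightarrow> encodes_pin (?w ! i) (p0 # ps) (Suc i)"
    and P: "pin_sequence (p0 # ps)" and ps: "pin_sequence ps"
    by (auto simp: pin_encoding_def pin_representation_def)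
  define qs where "qs = take ?n (drop ?e ps)"
  have len_qs: "length qs = ?n"
    using len by (simp add: qs_def)
  have qs_nth: "qs ! i = ps ! (?e + i)" if "i < ?n" for i
    using that len by (simp add: qs_def)
  have qs_take: "set (take i qs) \<subseteq> set (take (?e + i) ps)" for i
  proof -
    have "take i qs = take (min i ?n) (drop ?e ps)"
      by (simp add: qs_def)
    also have "set \<dots> \<subseteq> set (take i (drop ?e ps))"
      by (rule set_take_subset_set_take) simp
    also have "\<dots> \<subseteq> set (take (?e + i) ps)"
      by (auto simp: take_drop intro: in_set_dropD) (metis add.commute in_set_dropD)
    finally show ?thesis .
  qed
  \<comment> \<open>The origin occupies index 0 in both lists, so the shift by \<open>?e\<close>
    holds only from index 1 on.\<close>
  have P_take: "set (take i (p0 # qs)) \<subseteq> set (take (?e + i) (p0 # ps))" if "1 \<le> i" for i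
    using that qs_take[of "i - 1"] by (auto simp: take_Cons')
  have P_nth: "(p0 # qs) ! i = (p0 # ps) ! (?e + i)" if "1 \<le> i" "i < length (p0 # qs)" for i
    using that qs_nth[of "i - 1"] len_qs by (auto simp: nth_Cons')
  have "distinct (map fst (p0 # ps))" "distinct (map snd (p0 # ps))"
    using P by (auto simp: pin_sequence_def)
  then have dist: "distinct (map fst (p0 # qs))" "distinct (map snd (p0 # qs))"
    by (auto simp: qs_def take_map [symmetric] drop_map [symmetric]
        dest!: in_set_takeD in_set_dropD)
  have "pin_sequence qs"
    using dist len len_qs qs_nth qs_take by (intro pin_sequence_shift[OF ps, of _ ?e]) auto
  moreover have "pin_sequence (p0 # qs)"
    using len len_qs P_nth P_take dist by (intro pin_sequence_shift[OF P, of _ ?e]) auto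
  moreover have "encodes_pin ((a # t) ! i) (p0 # qs) (Suc i)" if "i < ?n" for i
  proof (cases i)
    case 0
    have "encodes_pin a (p0 # ps) (Suc ?e)"
      using letters[of ?e] by simp
    then have "independent_of (ps ! ?e) (set (take (Suc ?e) (p0 # ps)))"
      "in_quadrant a (ps ! ?e) (bounding_box (set (take (Suc ?e) (p0 # ps))))"
      using assms(2) by (auto simp: numerals_def)
    \<comment> \<open>Only the origin now precedes the first pin: independence is automatic, and the
      quadrant persists because the box shrinks.\<close>
    then have "independent_of (qs ! 0) {p0}" "in_quadrant a (qs ! 0) (bounding_box {p0})"
      using qs_nth[of 0] bounding_box_mono[of "set (take (Suc ?e) (p0 # ps))" "{p0}"]
      by (auto simp: independent_of_singleton intro: in_quadrant_mono)
    then show ?thesis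
      using 0 assms(2) by (auto simp: numerals_def)
  next
    case (Suc j)
    have "?w ! (?e + i) = (a # t) ! i"
      using that by (subst nth_append_length_plus) (simp only: nth_append if_True)
    then have old: "encodes_pin ((a # t) ! i) (p0 # ps) (Suc (?e + i))"
      using letters[of "?e + i"] that by simp
    show ?thesis
    \<comment> \<open>Here \<open>Suc i\<close> is at least 2, so the predecessor is again a pin of
      the factor and the origin remains to be separated from it.\<close>
    proof (rule encodes_pin_direction_shift[OF old])
      show "(a # t) ! i \<in> directions"
        using that Suc assms(3) by auto
      show "(p0 # qs) ! Suc i = (p0 # ps) ! Suc (?e + i)"
        "(p0 # qs) ! (Suc i - 1) = (p0 # ps) ! (Suc (?e + i) - 1)"
        using that Suc len_qs P_nth[of i] P_nth[of "Suc i"] by simp_all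
      show "set (take (Suc i - 1) (p0 # qs)) \<subseteq> set (take (Suc (?e + i) - 1) (p0 # ps))"
        "set (take (Suc i) (p0 # qs)) \<subseteq> set (take (Suc (?e + i)) (p0 # ps))"
        using Suc P_take[of i] P_take[of "Suc i"] by simp_all
    qed (use Suc in simp_all)
  qed
  ultimately have "pin_encoding p0 qs (a # t)"
    using pin_sequence_imp_representation[of qs] len_qs
    unfolding pin_encoding_def by (metis le_add1 length_Cons plus_1_eq_Suc)
  then have "pin_word (a # t)"
    unfolding pin_word_def by blast
  then show ?thesis
    using assms(2,3) by (simp add: SP_def)
qed

lemma direction_factor_in_M:
  assumes "pin_word (\<alpha> @ x @ \<beta>)" "2 \<le> length x" "set x \<subseteq> directions"
  shows "x \<in> \<M>"
  unfolding \<M>_def mem_Collect_eq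
proof (intro conjI assms(2,3) allI impI)
  fix i assume i: "Suc i < length x"
  obtain p0 ps where enc: "pin_encoding p0 ps (\<alpha> @ x @ \<beta>)"
    using assms(1) by (auto simp: pin_word_def)
  have "alternate (x ! i) (x ! Suc i)"
    using pin_encoding_alternate[OF enc, of "length \<alpha> + i"] i by (simp add: nth_append)
  moreover have "x ! i \<in> directions" "x ! Suc i \<in> directions"
    using assms(3) i by (auto dest: Suc_lessD)
  ultimately show "x ! i \<in> {L, R} \<longleftrightarrow> x ! Suc i \<in> {U, D}"
    by (auto simp: alternate_def directions_def)
qed

text \<open>What remains after a factor is empty or begins with a non-direction, that is, a numeral;
  hence the disjunctive hypothesis is preserved by the recursion.\<close>

lemma strong_decomp_factor:
  assumes "u = [] \<or> hd u \<in> numerals" "i < length (strong_decomp u)"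
  shows "\<exists>\<alpha> a t \<beta>. strong_decomp u ! i = a # t \<and> a \<in> numerals \<and> set t \<subseteq> directions \<and>
    u = \<alpha> @ (a # t) @ \<beta>"
  using assms
proof (induction u arbitrary: i rule: strong_decomp.induct)
  case 1
  then show ?case by simp
next
  case (2 a u)
  let ?t = "takeWhile (\<lambda>x. x \<in> directions) u" and ?r = "dropWhile (\<lambda>x. x \<in> directions) u"
  show ?case
  proof (cases i)
    case 0
    have "a # u = [] @ (a # ?t) @ ?r"
      by simp
    moreover have "set ?t \<subseteq> directions"
      by (auto dest: set_takeWhileD)
    ultimately show ?thesis
      using 0 2(2) by (metis list.distinct(1) list.sel(1) nth_Cons_0 strong_decomp.simps(2))
  next
    case (Suc j)
    have "?r = [] \<or> hd ?r \<in> numerals"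
      using hd_dropWhile not_in_directions_iff by blast
    moreover have "j < length (strong_decomp ?r)"
      using 2(3) Suc by simp
    ultimately obtain \<alpha> b t \<beta> where "strong_decomp ?r ! j = b # t" "b \<in> numerals"
      "set t \<subseteq> directions" "?r = \<alpha> @ (b # t) @ \<beta>"
      using 2(1) by blast
    moreover from this have "a # u = (a # ?t @ \<alpha>) @ (b # t) @ \<beta>"
      by (metis append.assoc append_Cons takeWhile_dropWhile_id)
    ultimately show ?thesis
      using Suc by (metis nth_Cons_Suc strong_decomp.simps(2))
  qed
qed

section \<open>Factors of images under the map \<open>\<phi>\<close>\<close>

lemma numeral_word_not_in_M: "a \<in> numerals \<Longrightarrow> a # t \<notin> \<M>"
  by (auto simp: \<M>_def numerals_def directions_def)

lemma phi_numeral_directions: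
  "a \<in> numerals \<Longrightarrow> [p, q] \<in> phi_numeral a \<Longrightarrow> p \<in> directions \<and> q \<in> directions"
  by (auto simp: numerals_def directions_def)

lemma phi_numeral_disjoint:
  "a \<in> numerals \<Longrightarrow> b \<in> numerals \<Longrightarrow> z \<in> phi_numeral a \<Longrightarrow> z \<in> phi_numeral b \<Longrightarrow> a = b"
  by (auto simp: numerals_def)

lemma varphi_side:
  assumes "b \<in> numerals" "c \<in> directions"
  shows "\<exists>p. varphi b c = [p, side b c, c] \<and> [p, side b c] \<in> phi_numeral b"
  using assms by (auto simp: numerals_def directions_def side_def)

text \<open>A common form for single numerals and longer words: the numeral becomes the two sides of
  its quadrant, in an order which the next letter, if any, determines.\<close>

lemma phi_strictE:
  assumes "z \<in> phi (a # t)" "a \<in> numerals" "set t \<subseteq> directions"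
  obtains p q where "z = p # q # t" "[p, q] \<in> phi_numeral a" "t \<noteq> [] \<Longrightarrow> q = side a (hd t)"
proof (cases t)
  case Nil
  then have "z \<in> phi_numeral a"
    using assms(1,2) numeral_word_not_in_M[OF assms(2)] by (simp add: phi_def)
  moreover from this obtain p q where "z = [p, q]"
    using assms(2) by (auto simp: numerals_def)
  ultimately show ?thesis
    using that Nil by blast
next
  case (Cons c s)
  then obtain p where "varphi a c = [p, side a c, c]" "[p, side a c] \<in> phi_numeral a"
    using varphi_side assms(2,3) by fastforce
  moreover have "phi (a # t) = {varphi a c @ s}"
    using Cons numeral_word_not_in_M[OF assms(2)] by (simp add: phi_def)
  ultimately show ?thesis
    using assms(1) Cons by (intro that[of p "side a c"]) simp_all
qed

text \<open>Of the two orders of the sides of the quadrant, only one lets \<open>q\<close> alternate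
  with the next letter, and it is the one chosen by \<open>varphi\<close>.\<close>

lemma phi_strictI:
  assumes "[p, q] \<in> phi_numeral a" "a \<in> numerals" "set t \<subseteq> directions"
    and "t \<noteq> [] \<Longrightarrow> alternate q (hd t)"
  shows "p # q # t \<in> phi (a # t)"
proof (cases t)
  case Nil
  then show ?thesis
    using assms(1,2) numeral_word_not_in_M by (simp add: phi_def)
next
  case (Cons c s)
  have "varphi a c = [p, q, c]"
    using assms Cons by (auto simp: numerals_def directions_def alternate_def)
  then show ?thesis
    using Cons assms(2) numeral_word_not_in_M by (simp add: phi_def)
qed

lemma phi_has_factor_in_refl:
  assumes "a \<in> numerals"
  shows "phi_has_factor_in (a # t) (a # t)"
proof -
  have "phi (a # t) \<noteq> {}"
    using assms by (auto simp: phi_def numerals_def)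
  then show ?thesis
    unfolding phi_has_factor_in_def by blast
qed

text \<open>If \<open>b\<close> is a direction, the word is in \<open>\<M>\<close>, is fixed by
  \<open>phi\<close> and already lies in \<open>phi (a # t)\<close>. If \<open>b\<close> is a
  numeral, \<open>phi\<close> yields the same word \<open>side b c # c # t\<close> with one letter
  in front.\<close>

lemma phi_has_factor_inI:
  assumes "pin_word (\<alpha> @ (b # c # t) @ \<beta>)" "a \<in> numerals" "set (c # t) \<subseteq> directions"
    and "[side b c, c] \<in> phi_numeral a"
  shows "b # c # t \<in> SP \<union> \<M> \<and> phi_has_factor_in (b # c # t) (a # t)"
proof -
  obtain p0 ps where "pin_encoding p0 ps (\<alpha> @ (b # c # t) @ \<beta>)"
    using assms(1) by (auto simp: pin_word_def)
  then have "alternate c (hd t)" if "t \<noteq> []"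
    using that pin_encoding_alternate[of p0 ps "\<alpha> @ (b # c # t) @ \<beta>" "Suc (length \<alpha>)"]
    by (cases t) (simp_all add: nth_append)
  then have z: "side b c # c # t \<in> phi (a # t)"
    using assms(2-4) by (intro phi_strictI) auto
  show ?thesis
  proof (cases "b \<in> directions")
    case True
    then have M: "b # c # t \<in> \<M>"
      using assms(3) by (intro direction_factor_in_M[OF assms(1)]) auto
    then have "phi (b # c # t) = {side b c # c # t}"
      using True by (simp add: phi_def side_def)
    then show ?thesis
      using M z by (auto simp: phi_has_factor_in_def)
  next
    case False
    then have b: "b \<in> numerals"
      by (simp add: not_in_directions_iff)
    then obtain p where "varphi b c = [p, side b c, c]"
      using varphi_side assms(3) by fastforce
    then have "phi (b # c # t) = {[p] @ (side b c # c # t)}"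
      using numeral_word_not_in_M[OF b] by (simp add: phi_def)
    moreover have "sublist (side b c # c # t) ([p] @ (side b c # c # t))"
      by (rule sublist_append_leftI)
    ultimately have "phi_has_factor_in (b # c # t) (a # t)"
      using z unfolding phi_has_factor_in_def by blast
    then show ?thesis
      using strict_factor_in_SP[OF assms(1) b assms(3)] by blast
  qed
qed

lemma phi_has_factor_inE:
  assumes "x \<in> SP \<union> \<M>" "phi_has_factor_in x (a # t)" "a \<in> numerals" "set t \<subseteq> directions"
  shows "\<exists>\<alpha> y \<beta>. x = \<alpha> @ y @ \<beta> \<and> (y = a # t \<or>
    (\<exists>c. y = c # t \<and> c \<in> directions \<and> \<alpha> \<noteq> [] \<and> [side (last \<alpha>) c, c] \<in> phi_numeral a))"
proof -
  obtain y z where y: "y \<in> phi x" and "z \<in> phi (a # t)" and "sublist z y"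
    using assms(2) by (auto simp: phi_has_factor_in_def)
  then obtain p q \<alpha> \<beta> where pq: "[p, q] \<in> phi_numeral a" and y_eq: "y = \<alpha> @ (p # q # t) @ \<beta>"
    using phi_strictE[OF _ assms(3,4)] by (metis sublist_def)
  have p: "p \<in> directions" and q: "q \<in> directions"
    using phi_numeral_directions[OF assms(3) pq] by auto
  \<comment> \<open>This covers the occurrences whose letter \<open>p\<close> is itself a letter of
    \<open>x\<close>; since \<open>p\<close> is a direction, \<open>side p q\<close> is
    \<open>p\<close>.\<close>
  have inner: ?thesis if "x = (\<gamma> @ [p]) @ (q # t) @ \<beta>" for \<gamma>
  proof (intro exI conjI disjI2)
    show "[side (last (\<gamma> @ [p])) q, q] \<in> phi_numeral a"
      using pq p by (simp add: side_def)
  qed (use that q in auto)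
  show ?thesis
  proof (cases "x \<in> \<M>")
    case True
    then show ?thesis
      using y y_eq by (intro inner[of \<alpha>]) (simp add: phi_def)
  next
    case False
    then obtain b s where x: "x = b # s" and b: "b \<in> numerals" and s: "set s \<subseteq> directions"
      using assms(1) by (cases x) (auto simp: SP_def)
    obtain p' q' where y': "y = p' # q' # s" "[p', q'] \<in> phi_numeral b"
        "s \<noteq> [] \<Longrightarrow> q' = side b (hd s)"
      using phi_strictE[OF y[unfolded x] b s] by blast
    \<comment> \<open>The letters \<open>p'\<close> and \<open>q'\<close> both stem from the numeral
      \<open>b\<close>, so an occurrence may start at the first, at the second, or after
      both.\<close>
    consider "\<alpha> = []" | "\<alpha> = [p']" | \<gamma> where "\<alpha> = p' # q' # \<gamma>"
      using y_eq y'(1) by (auto simp: Cons_eq_append_conv)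
    then show ?thesis
    proof cases
      case 1
      then have "p = p'" "q = q'" "s = t @ \<beta>"
        using y_eq y'(1) by auto
      moreover from this have "b = a"
        using phi_numeral_disjoint[OF b assms(3)] pq y'(2) by blast
      ultimately have "x = [] @ (a # t) @ \<beta>"
        using x by simp
      then show ?thesis
        by blast
    next
      case 2
      \<comment> \<open>Here \<open>p\<close> is not a letter of \<open>x\<close>: it is the side of
        the quadrant \<open>b\<close> perpendicular to \<open>q\<close>, and \<open>b\<close> is the
        letter before \<open>q\<close>.\<close>
      then have "q' = p" "s = q # t @ \<beta>"
        using y_eq y'(1) by auto
      then have "x = [b] @ (q # t) @ \<beta>" "[side (last [b]) q, q] \<in> phi_numeral a"
        using x y'(3) pq by auto
      then show ?thesis
        using q by blast
    next
      case 3
      then show ?thesis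
        using y_eq y'(1) x by (intro inner[of "b # \<gamma>"]) auto
    qed
  qed
qed

section \<open>Decompositions of a word\<close>

lemma interleave_0: "interleave v x 0 = v 0"
  by (simp add: interleave_def)

lemma interleave_Suc: "interleave v x (Suc i) = interleave v x i @ x i @ v (Suc i)"
  by (simp add: interleave_def)

text \<open>The ends \<open>A l\<close> and \<open>B (Suc l)\<close> of the factor
  \<open>X l\<close> move into the gaps before and after it. The prefix for \<open>v\<close> also
  contains \<open>A i\<close>, which belongs to the factor \<open>X i\<close> still to come.\<close>

lemma interleave_regroup:
  assumes "B 0 = []" "\<And>l. l \<le> i \<Longrightarrow> v l = B l @ V l @ A l"
    and "\<And>l. l < i \<Longrightarrow> X l = A l @ x l @ B (Suc l)"
  shows "interleave v x i = interleave V X i @ A i"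
  using assms by (induction i) (simp_all add: interleave_0 interleave_Suc)

lemma interleave_split:
  assumes "i < j"
  shows "\<exists>\<beta>. interleave v x j = interleave v x i @ x i @ \<beta>"
  using assms
proof (induction j)
  case (Suc j)
  then show ?case
    by (cases "i = j") (auto simp: interleave_Suc)
qed simp

section \<open>The two implications\<close>

text \<open>Each factor \<open>x i\<close> is trimmed to the part \<open>y i\<close> that matches
  the factor of \<open>u\<close>; the remainders go into the gaps. Any encoding of \<open>w\<close>
  serves as witness.\<close>

lemma pin_leI:
  assumes "pin_word u" and enc: "pin_encoding p0 ps w" and j: "j = length (strong_decomp u)"
    and w: "w = interleave v x j"
    and factors: "\<And>i. i < j \<Longrightarrow>
      x i \<in> SP \<union> \<M> \<and> phi_has_factor_in (x i) (strong_decomp u ! i)"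
  shows "u \<preceq> w"
proof -
  let ?us = "strong_decomp u"
  have us: "\<exists>a t. ?us ! i = a # t \<and> a \<in> numerals \<and> set t \<subseteq> directions" if "i < j" for i
    using strong_decomp_factor[of u i] hd_pin_word[OF assms(1)] that j by blast
  have "\<exists>\<alpha> y \<beta>. x i = \<alpha> @ y @ \<beta> \<and> (y = ?us ! i \<or>
      (\<exists>c. y = c # tl (?us ! i) \<and> c \<in> directions \<and> \<alpha> \<noteq> [] \<and>
        [side (last \<alpha>) c, c] \<in> phi_numeral (hd (?us ! i))))" if i: "i < j" for i
  proof -
    obtain a t where at: "?us ! i = a # t" "a \<in> numerals" "set t \<subseteq> directions"
      using us[OF i] by blast
    show ?thesis
      using phi_has_factor_inE[of "x i" a t] factors[OF i] at by simp
  qed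
  then obtain A y B where x: "\<And>i. i < j \<Longrightarrow> x i = A i @ y i @ B i"
    and y: "\<And>i. i < j \<Longrightarrow> y i = ?us ! i \<or>
      (\<exists>c. y i = c # tl (?us ! i) \<and> c \<in> directions \<and> A i \<noteq> [] \<and>
        [side (last (A i)) c, c] \<in> phi_numeral (hd (?us ! i)))"
    by metis
  \<comment> \<open>No factor follows the gap \<open>j\<close>, so it gains nothing on its right;
    \<open>B'\<close> shifts the index, as the remainder of factor \<open>l\<close> joins gap
    \<open>Suc l\<close>.\<close>
  define A' where "A' i = (if i < j then A i else [])" for i
  define B' where "B' i = (case i of 0 \<Rightarrow> [] | Suc l \<Rightarrow> B l)" for i
  define v' where "v' i = B' i @ v i @ A' i" for i
  have regroup: "interleave v' y i = interleave v x i @ A' i" if "i \<le> j" for i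
    using that x by (intro interleave_regroup[of B']) (auto simp: v'_def A'_def B'_def)
  have w': "w = interleave v' y j"
    using regroup[of j] w by (simp add: A'_def)
  have "y i \<noteq> [] \<and> (hd (y i) \<in> numerals \<longrightarrow> y i = ?us ! i) \<and>
      (hd (y i) \<in> directions \<longrightarrow> v' i \<noteq> [] \<and>
        in_quadrant (hd (?us ! i)) (ps ! length (interleave v' y i)) {p0} \<and>
        tl (y i) = tl (?us ! i))" if i: "i < j" for i
  proof -
    obtain a t where at: "?us ! i = a # t" "a \<in> numerals"
      using us[OF i] by blast
    show ?thesis
    proof (cases "y i = ?us ! i")
      case True
      then show ?thesis
        using at by (simp flip: not_in_directions_iff)
    next
      case False
      then obtain c where c: "y i = c # t" "c \<in> directions" "A i \<noteq> []"
        and corner: "[side (last (A i)) c, c] \<in> phi_numeral a"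
        using y[OF i] at(1) by auto
      \<comment> \<open>As \<open>A i\<close> is nonempty, its last letter directly precedes
        \<open>y i\<close> in \<open>w\<close>, and this pair of letters determines the
        quadrant.\<close>
      have "interleave v' y i \<noteq> []" and last: "last (interleave v' y i) = last (A i)"
        using regroup[of i] i c(3) by (auto simp: A'_def)
      then obtain k where k: "length (interleave v' y i) = Suc k"
        by (metis length_Suc_conv neq_Nil_conv)
      then have "interleave v' y i ! k = last (A i)"
        using last \<open>interleave v' y i \<noteq> []\<close> by (simp add: last_conv_nth)
      moreover obtain \<beta> where \<beta>: "w = interleave v' y i @ (c # t) @ \<beta>"
        using interleave_split[OF i, of v' y] w' c(1) by metis
      ultimately have nth: "w ! Suc k = c" "w ! k = last (A i)" "Suc k < length w"
        using k by (simp_all add: \<beta> nth_append)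
      have "in_quadrant a (ps ! Suc k) {p0}"
        using pin_encoding_quadrant[OF enc nth(3) _ at(2)] nth c(2) corner by simp
      then show ?thesis
        using c at k i by (auto simp: v'_def A'_def simp flip: not_in_directions_iff)
    qed
  qed
  then show ?thesis
    unfolding pin_le_def using enc w' j by blast
qed

text \<open>A factor led by a direction takes over the last letter of the nonempty gap before it,
  which reveals the quadrant of its first point. A factor led by a numeral stays as it is and lies
  in \<open>SP\<close> as a factor of \<open>u\<close>.\<close>

lemma pin_leE:
  assumes "pin_word u" "u \<preceq> w" and j: "j = length (strong_decomp u)"
  shows "\<exists>v x. w = interleave v x j \<and>
    (\<forall>i < j. x i \<in> SP \<union> \<M> \<and> phi_has_factor_in (x i) (strong_decomp u ! i))"
proof -
  let ?us = "strong_decomp u"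
  obtain p0 ps v y where enc: "pin_encoding p0 ps w" and w: "w = interleave v y j"
    and y: "\<And>i. i < j \<Longrightarrow> y i \<noteq> [] \<and> (hd (y i) \<in> numerals \<longrightarrow> y i = ?us ! i) \<and>
      (hd (y i) \<in> directions \<longrightarrow> v i \<noteq> [] \<and>
        in_quadrant (hd (?us ! i)) (ps ! length (interleave v y i)) {p0} \<and>
        tl (y i) = tl (?us ! i))"
    using assms(2) unfolding pin_le_def j by blast
  have pw: "pin_word w"
    using enc unfolding pin_word_def by blast
  define A where "A i = (if i < j \<and> hd (y i) \<in> directions then [last (v i)] else [])" for i
  define V where "V i = (if i < j \<and> hd (y i) \<in> directions then butlast (v i) else v i)" for i
  define x where "x i = A i @ y i" for i
  have "v i = V i @ A i" for i
    using y[of i] by (auto simp: V_def A_def)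
  then have regroup: "interleave v y i = interleave V x i @ A i" if "i \<le> j" for i
    by (intro interleave_regroup[of "\<lambda>_. []"]) (simp_all add: x_def)
  have w': "w = interleave V x j"
    using regroup[of j] w by (simp add: A_def)
  have "x i \<in> SP \<union> \<M> \<and> phi_has_factor_in (x i) (?us ! i)" if i: "i < j" for i
  proof -
    obtain \<gamma> a t \<delta> where at: "?us ! i = a # t" "a \<in> numerals" "set t \<subseteq> directions"
      and u: "u = \<gamma> @ (a # t) @ \<delta>"
      using strong_decomp_factor[of u i] hd_pin_word[OF assms(1)] i j by blast
    show ?thesis
    proof (cases "hd (y i) \<in> directions")
      case False
      then have "x i = a # t"
        using y[OF i] at(1) by (simp add: x_def A_def not_in_directions_iff)
      then show ?thesis
        using strict_factor_in_SP[OF assms(1)[unfolded u] at(2,3)]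
          phi_has_factor_in_refl[OF at(2)] at(1) by auto
    next
      case True
      then obtain c where c: "y i = c # t" "c \<in> directions"
        using y[OF i] at(1) by (cases "y i") auto
      define b where "b = last (v i)"
      obtain \<beta> where \<beta>: "w = interleave V x i @ (b # c # t) @ \<beta>"
        using interleave_split[OF i, of V x] w' c True i by (auto simp: x_def A_def b_def)
      let ?k = "length (interleave V x i)"
      have nth: "w ! Suc ?k = c" "w ! ?k = b" "Suc ?k < length w"
        by (simp_all add: \<beta> nth_append)
      \<comment> \<open>The borrowed letter \<open>b\<close> has index \<open>?k\<close>, so the
        point in the quadrant condition is \<open>ps ! Suc ?k\<close>, encoded by
        \<open>c\<close>.\<close>
      have "length (interleave v y i) = Suc ?k"
        using regroup[of i] i True by (simp add: A_def)
      then have "in_quadrant a (ps ! Suc ?k) {p0}"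
        using y[OF i] True at(1) by simp
      then have "[side b c, c] \<in> phi_numeral a"
        using pin_encoding_quadrant[OF enc nth(3) _ at(2)] nth c(2) by simp
      moreover have "x i = b # c # t"
        using i True c by (simp add: x_def A_def b_def)
      ultimately show ?thesis
        using phi_has_factor_inI[of "interleave V x i" b c t \<beta> a] pw \<beta> at c(2) by simp
    qed
  qed
  then show ?thesis
    using w' by blast
qed

theorem theorem3p13:
  fixes u w :: "letter list" and us :: "letter list list"
  assumes "pin_word u" and "pin_word w" and "us = strong_decomp u"
  shows "u \<preceq> w \<longleftrightarrow>
    (\<exists>v x. w = interleave v x (length us) \<and>
      (\<forall>i < length us. x i \<in> SP \<union> \<M> \<and> phi_has_factor_in (x i) (us ! i)))"
proof
  assume "u \<preceq> w"
  then show "\<exists>v x. w = interleave v x (length us) \<and>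
      (\<forall>i < length us. x i \<in> SP \<union> \<M> \<and> phi_has_factor_in (x i) (us ! i))"
    using pin_leE[OF assms(1)] assms(3) by blast
next
  assume "\<exists>v x. w = interleave v x (length us) \<and>
      (\<forall>i < length us. x i \<in> SP \<union> \<M> \<and> phi_has_factor_in (x i) (us ! i))"
  \<comment> \<open>The factorization mentions no points, so an encoding of \<open>w\<close> is
    taken from \<open>pin_word w\<close>.\<close>
  moreover obtain p0 ps where "pin_encoding p0 ps w"
    using assms(2) by (auto simp: pin_word_def)
  ultimately show "u \<preceq> w"
    using pin_leI[OF assms(1)] assms(3) by blast
qed

end
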